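(* Let $n\ge k\ge 1$ be positive integers such that $k$ divides $n$, and let $c=n/k$. Let $\mathcal{P}\subseteq\mathcal{U}^n_k$ be a $1$-intersecting uniform partition system. Then $|\mathcal{P}|\le U(n-c,k-1)$. Moreover, this bound holds with equality if and only if $\mathcal{P}$ is a trivially $1$-intersecting uniform partition system.
   Context: For $n=ck$, $\mathcal{U}^n_k$ is the set of all uniform $k$-partitions of $\{1,\dots,n\}$, i.e. partitions into $k$ classes each of size $c=n/k$, and $U(n,k)=|\mathcal{U}^n_k|=\frac1{k!}\binom nc\binom{n-c}c\cdots\binom cc$ (with $U(0,0)=1$). A set $\mathcal{P}\subseteq\mathcal{U}^n_k$ is $t$-intersecting if $|P\cap Q|\ge t$ for all $P,Q\in\mathcal{P}$, where $P\cap Q$ is the set of classes common to $P$ and $Q$. A set $\mathcal{P}\subseteq\mathcal{U}^n_k$ is a trivially $t$-intersecting uniform partition system if, up to a permutation of $\{1,\dots,n\}$, it equals $$\{P\in\mathcal{U}^n_k:\ \{[1,c],[c+1,2c],\dots,[(t-1)c+1,tc]\}\subseteq P\},$$ where $[a,b]=\{a,a+1,\dots,b\}$; that is, it consists of all uniform $k$-partitions containing $t$ fixed pairwise disjoint $c$-sets as classes. *)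

theory Defs
  imports Main "HOL-Library.Disjoint_Sets" "HOL-Combinatorics.Permutations"
begin

(* The constraints force n = k * (n div k), so the set is empty if k does not divide n.
   For n = k = 0 its only element is the empty partition, so that U 0 0 = 1. *)
definition uniform_partitions :: "nat \<Rightarrow> nat \<Rightarrow> nat set set set" where
  "uniform_partitions n k =
     {P. partition_on {1..n} P \<and> card P = k \<and> (\<forall>A\<in>P. card A = n div k)}"

definition U :: "nat \<Rightarrow> nat \<Rightarrow> nat" where
  "U n k = card (uniform_partitions n k)"

definition t_intersecting :: "nat \<Rightarrow> nat set set set \<Rightarrow> bool" where
  "t_intersecting t \<P> \<longleftrightarrow> (\<forall>P\<in>\<P>. \<forall>Q\<in>\<P>. t \<le> card (P \<inter> Q))"

definition canonical_system :: "nat \<Rightarrow> nat \<Rightarrow> nat \<Rightarrow> nat set set set" where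
  "canonical_system n k t =
     (let c = n div k
      in {P \<in> uniform_partitions n k. (\<lambda>i. {i * c + 1..(i + 1) * c}) ` {0..<t} \<subseteq> P})"

(* A permutation acts elementwise on the sets in each partition of the system. *)
definition trivially_t_intersecting ::
  "nat \<Rightarrow> nat \<Rightarrow> nat \<Rightarrow> nat set set set \<Rightarrow> bool" where
  "trivially_t_intersecting n k t \<P> \<longleftrightarrow>
     (\<exists>\<sigma>. \<sigma> permutes {1..n} \<and>
        \<P> = (\<lambda>P. (\<lambda>A. \<sigma> ` A) ` P) ` canonical_system n k t)"

lemma U_0_0: "U 0 0 = 1"
proof -
  have "uniform_partitions 0 0 = {{}}"
    by (auto simp: uniform_partitions_def partition_on_def)
  then show ?thesis by (simp add: U_def)
qed

end

theory Submission
  imports Defs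
begin

text \<open>
  Write \<open>u j\<close> for the number of partitions of \<open>c * j\<close> points into classes of size \<open>c\<close>.
  If some class \<open>A\<close> lies in every member of the system, then removing \<open>A\<close> embeds the system into
  the partitions of the remaining \<open>c * (k - 1)\<close> points. This gives the bound, with equality
  exactly when every partition containing \<open>A\<close> occurs; a permutation moves \<open>A\<close> to the first
  \<open>c\<close> points. For \<open>c = 1\<close> the class \<open>{1}\<close> is always common. What has to be shown is that a
  nonempty system with \<open>c \<ge> 2\<close> and no common class has strictly fewer than \<open>u (k - 1)\<close> members
  (\<open>card_lt_if_no_common_block\<close>).

  Call a set of classes a cover if it meets every member, and let \<open>r\<close> be the smallest size of a
  cover. No common class means \<open>r \<ge> 2\<close>, and \<open>r \<le> k\<close> because each member is itself a cover.
  If \<open>S\<close> has fewer than \<open>r\<close> classes, some member \<open>Q\<close> avoids \<open>S\<close>. Every member containing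
  \<open>S\<close> shares a class with \<open>Q\<close>, and that class is disjoint from \<open>\<Union>S\<close>, so there are at most
  \<open>k - card S\<close> choices for it, and at most \<open>k - 2\<close> choices if \<open>S\<close> is a single class. Branching
  in this way until \<open>r\<close> classes are known, when \<open>u (k - r)\<close> completions remain, bounds the
  number of members containing a given class by
  \<open>d = (k - 2) * (\<Prod>i=2..<r. k - i) * u (k - r)\<close>.

  On the other hand \<open>u (j + 1) \<ge> (2 * j + 1) * u j\<close>: a branching step with \<open>j\<close> choices
  multiplies the count by \<open>j\<close>, while fixing one class fewer multiplies \<open>u\<close> by at least
  \<open>2 * j - 1\<close>. For \<open>r < k\<close> this makes the union bound \<open>r * d\<close> over a minimum
  cover smaller than \<open>u (k - 1)\<close>. For \<open>r = k\<close> the union bound is too weak for \<open>c = 2\<close> and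
  \<open>k = 3\<close> or \<open>k = 4\<close>, but then a member \<open>P\<close> can serve as the cover. The union bound
  counts \<open>P\<close> itself \<open>k\<close> times; counting it once gives at most \<open>1 + k * (d - 1)\<close> members, which is enough.
\<close>

section \<open>Partitions into classes of equal size\<close>

text \<open>The ground set is arbitrary so that deleting classes from a partition gives an object of the
  same kind; the number of classes is determined by the size of the ground set.\<close>

definition equipartitions :: "nat \<Rightarrow> 'a set \<Rightarrow> 'a set set set" where
  "equipartitions c X = {P. partition_on X P \<and> (\<forall>A\<in>P. card A = c)}"

lemma equipartitionsD:
  assumes "P \<in> equipartitions c X"
  shows "\<Union>P = X" and "A \<in> P \<Longrightarrow> card A = c" and "A \<in> P \<Longrightarrow> A \<subseteq> X" and "A \<in> P \<Longrightarrow> A \<noteq> {}"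
    and "A \<in> P \<Longrightarrow> B \<in> P \<Longrightarrow> A \<noteq> B \<Longrightarrow> A \<inter> B = {}"
  using assms by (auto simp: equipartitions_def partition_on_def disjoint_def)

lemma finite_equipartitions: "finite X \<Longrightarrow> finite (equipartitions c X)"
  unfolding equipartitions_def by (rule finite_subset[OF _ finitely_many_partition_on]) auto

lemma finite_equipartition:
  "finite X \<Longrightarrow> P \<in> equipartitions c X \<Longrightarrow> finite P"
  by (auto simp: equipartitions_def intro: finite_elements)

lemma card_equal_blocks:
  assumes "finite X" "P \<in> equipartitions c X" "S \<subseteq> P"
  shows "card (\<Union>S) = c * card S"
proof (rule card_partition[symmetric])
  show "finite S" using assms finite_equipartition finite_subset by metis
  show "finite (\<Union>S)"
    by (rule finite_subset[of _ X]) (use assms equipartitionsD(1)[OF assms(2)] in auto)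
  show "\<And>A B. A \<in> S \<Longrightarrow> B \<in> S \<Longrightarrow> A \<noteq> B \<Longrightarrow> A \<inter> B = {}"
    using assms(3) equipartitionsD(5)[OF assms(2)] by (meson subsetD)
qed (use assms(3) equipartitionsD(2)[OF assms(2)] in auto)

lemma card_equipartition:
  assumes "finite X" "P \<in> equipartitions c X"
  shows "card X = c * card P"
  using card_equal_blocks[OF assms subset_refl] equipartitionsD(1)[OF assms(2)] by simp

lemma equipartitions_empty: "equipartitions c {} = {{}}"
  by (auto simp: equipartitions_def partition_on_empty)

lemma image_equipartition:
  assumes "bij_betw f X Y" "P \<in> equipartitions c X"
  shows "(`) f ` P \<in> equipartitions c Y"
proof -
  have inj: "inj_on f X" and im: "f ` X = Y" using assms(1) by (auto simp: bij_betw_def)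
  have "partition_on Y ((`) f ` P - {{}})"
    using partition_on_inj_image[of X P f] inj im assms(2) by (simp add: equipartitions_def)
  moreover have "(`) f ` P - {{}} = (`) f ` P"
    using equipartitionsD(4)[OF assms(2)] by auto
  moreover have "card (f ` A) = c" if "A \<in> P" for A
    using that equipartitionsD(2,3)[OF assms(2)] inj by (metis card_image inj_on_subset)
  ultimately show ?thesis by (auto simp: equipartitions_def)
qed

lemma image_image_inverse:
  assumes "\<And>x. x \<in> \<Union>P \<Longrightarrow> g (f x) = x"
  shows "(`) g ` ((`) f ` P) = P"
proof -
  have "g ` f ` A = A" if "A \<in> P" for A
    using assms that by (force simp: image_image)
  then show ?thesis by (simp add: image_image)
qed

lemma card_equipartitions_cong:
  assumes "finite X" "finite Y" "card X = card Y"
  shows "card (equipartitions c X) = card (equipartitions c Y)"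
proof -
  obtain f where f: "bij_betw f X Y"
    using finite_same_card_bij[OF assms] by blast
  let ?g = "the_inv_into X f"
  have g: "bij_betw ?g Y X" using f by (rule bij_betw_the_inv_into)
  have "bij_betw (\<lambda>P. (`) f ` P) (equipartitions c X) (equipartitions c Y)"
  proof (rule bij_betw_byWitness[where f' = "\<lambda>P. (`) ?g ` P"])
    show "\<forall>P\<in>equipartitions c X. (`) ?g ` (`) f ` P = P"
      by (intro ballI image_image_inverse)
         (use f equipartitionsD(1) in \<open>metis bij_betw_def the_inv_into_f_f\<close>)
    show "\<forall>P\<in>equipartitions c Y. (`) f ` (`) ?g ` P = P"
      by (intro ballI image_image_inverse)
         (use f equipartitionsD(1) in \<open>metis bij_betw_def f_the_inv_into_f\<close>)
  qed (use image_equipartition[OF f] image_equipartition[OF g] in auto)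
  then show ?thesis by (rule bij_betw_same_card)
qed

text \<open>Deleting the prescribed classes is a bijection onto the partitions of what is left.\<close>
lemma card_equipartitions_containing:
  assumes "finite X" "disjoint S" "\<Union>S \<subseteq> X" "\<And>A. A \<in> S \<Longrightarrow> card A = c" "0 < c"
  shows "card {P \<in> equipartitions c X. S \<subseteq> P} = card (equipartitions c (X - \<Union>S))"
proof -
  have ne: "{} \<notin> S" using assms(4,5) by force
  have "bij_betw (\<lambda>P. P - S) {P \<in> equipartitions c X. S \<subseteq> P} (equipartitions c (X - \<Union>S))"
  proof (rule bij_betw_byWitness[where f' = "\<lambda>Q. Q \<union> S"])
    show "\<forall>Q\<in>equipartitions c (X - \<Union>S). Q \<union> S - S = Q"
      using equipartitionsD(3,4)[where X = "X - \<Union>S"] by fastforce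
    show "(\<lambda>P. P - S) ` {P \<in> equipartitions c X. S \<subseteq> P} \<subseteq> equipartitions c (X - \<Union>S)"
    proof clarify
      fix P assume P: "P \<in> equipartitions c X" "S \<subseteq> P"
      note D = equipartitionsD[OF P(1)]
      have "\<Union>(P - S) = X - \<Union>S"
        using D(1) D(5) P(2) by fastforce
      then show "P - S \<in> equipartitions c (X - \<Union>S)"
        using P(1) by (auto simp: equipartitions_def partition_on_def disjoint_def)
    qed
    show "(\<lambda>Q. Q \<union> S) ` equipartitions c (X - \<Union>S) \<subseteq> {P \<in> equipartitions c X. S \<subseteq> P}"
    proof clarify
      fix Q assume Q: "Q \<in> equipartitions c (X - \<Union>S)"
      note D = equipartitionsD[OF Q]
      have "\<Union>(Q \<union> S) = X" using D(1) assms(3) by auto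
      moreover have "disjoint (Q \<union> S)"
        using disjoint_union[of Q S] assms(2) Q D(1)
        by (auto simp: equipartitions_def partition_on_def)
      ultimately show "Q \<union> S \<in> equipartitions c X \<and> S \<subseteq> Q \<union> S"
        using Q ne assms(4) by (auto simp: equipartitions_def partition_on_def)
    qed
  qed auto
  then show ?thesis by (rule bij_betw_same_card)
qed

lemma binomial_ge_self:
  "0 < m \<Longrightarrow> m < n \<Longrightarrow> n \<le> n choose m"
proof (induction n arbitrary: m)
  case (Suc n)
  obtain l where l: "m = Suc l" using Suc.prems(1) by (cases m) auto
  have pos: "0 < n choose l" using Suc.prems l by simp
  show ?case
  proof (cases "m < n")
    case True
    then show ?thesis using Suc.IH[of m] Suc.prems(1) pos l by (simp del: One_nat_def; linarith)
  next
    case False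
    then have "m = n" using Suc.prems(2) by simp
    then show ?thesis by (simp)
  qed
qed simp

text \<open>Fix a point \<open>x\<close> and classify by the class containing it. There are
  \<open>(c * (j + 1) - 1) choose (c - 1)\<close> candidates for that class, and each leaves \<open>c * j\<close> points to
  be partitioned. The factor \<open>2 * j + 1\<close> is exact for \<open>c = 2\<close> (perfect matchings), which is the
  tight case of the whole argument.\<close>
lemma card_equipartitions_mult_le:
  assumes "2 \<le> c" "finite X" "finite Y" "card X = c * Suc j" "card Y = c * j"
  shows "(2 * j + 1) * card (equipartitions c Y) \<le> card (equipartitions c X)"
proof -
  have "X \<noteq> {}" using assms by auto
  then obtain x where x: "x \<in> X" by blast
  define \<A> where "\<A> = insert x ` {B. B \<subseteq> X - {x} \<and> card B = c - 1}"
  have A: "A \<subseteq> X" "x \<in> A" "card A = c" if "A \<in> \<A>" for A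
    using that x assms(1,2) finite_subset[of _ "X - {x}"]
    by (auto simp: \<A>_def card_insert_if)
  have finA: "finite \<A>" unfolding \<A>_def using assms(2) by auto
  have "card \<A> = card {B. B \<subseteq> X - {x} \<and> card B = c - 1}"
    unfolding \<A>_def
    by (rule card_image) (auto simp: inj_on_def dest: insert_ident[THEN iffD1, rotated -1])
  also have "\<dots> = (c * Suc j - 1) choose (c - 1)"
    using n_subsets[of "X - {x}" "c - 1"] assms x by simp
  also have "\<dots> \<ge> 2 * j + 1"
  proof (cases j)
    case (Suc i)
    have "2 * j \<le> c * j" using assms(1) by simp
    then have "2 * j + 1 \<le> c * Suc j - 1" using assms(1) by (simp; linarith)
    also have "\<dots> \<le> (c * Suc j - 1) choose (c - 1)"
      by (rule binomial_ge_self) (use assms(1) Suc in auto)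
    finally show ?thesis .
  qed simp
  finally have "(2 * j + 1) * card (equipartitions c Y)
      \<le> card \<A> * card (equipartitions c Y)" by (rule mult_le_mono1)
  also have "\<dots> = (\<Sum>A\<in>\<A>. card {P \<in> equipartitions c X. {A} \<subseteq> P})"
  proof -
    have "card {P \<in> equipartitions c X. {A} \<subseteq> P} = card (equipartitions c Y)"
      if "A \<in> \<A>" for A
    proof -
      have "card {P \<in> equipartitions c X. {A} \<subseteq> P} = card (equipartitions c (X - \<Union>{A}))"
        by (rule card_equipartitions_containing) (use A[OF that] assms in auto)
      also have "\<dots> = card (equipartitions c Y)"
        by (rule card_equipartitions_cong)
           (use A[OF that] assms in \<open>auto simp: card_Diff_subset finite_subset\<close>)
      finally show ?thesis .
    qed
    then show ?thesis by simp
  qed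
  also have "\<dots> = card (\<Union>A\<in>\<A>. {P \<in> equipartitions c X. {A} \<subseteq> P})"
  proof (rule card_UN_disjoint[symmetric])
    show "\<forall>A\<in>\<A>. \<forall>B\<in>\<A>. A \<noteq> B \<longrightarrow>
        {P \<in> equipartitions c X. {A} \<subseteq> P} \<inter> {P \<in> equipartitions c X. {B} \<subseteq> P} = {}"
      using A(2) equipartitionsD(5) by fastforce
  qed (use finA finite_equipartitions[OF assms(2)] in auto)
  also have "\<dots> \<le> card (equipartitions c X)"
    by (rule card_mono) (use finite_equipartitions[OF assms(2)] in auto)
  finally show ?thesis .
qed

definition num_equipartitions :: "nat \<Rightarrow> nat \<Rightarrow> nat" where
  "num_equipartitions c j = card (equipartitions c {..<c * j})"

lemma card_equipartitions:
  assumes "finite X" "card X = c * j"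
  shows "card (equipartitions c X) = num_equipartitions c j"
  unfolding num_equipartitions_def
  by (rule card_equipartitions_cong) (use assms in auto)

lemma num_equipartitions_0: "num_equipartitions c 0 = 1"
  by (simp add: num_equipartitions_def equipartitions_empty)

lemma num_equipartitions_Suc:
  "2 \<le> c \<Longrightarrow> (2 * j + 1) * num_equipartitions c j \<le> num_equipartitions c (Suc j)"
  unfolding num_equipartitions_def by (rule card_equipartitions_mult_le) auto

section \<open>Growth estimates\<close>

text \<open>The left side does not increase with \<open>r\<close>: passing from \<open>r\<close> to \<open>r + 1\<close> with
  \<open>j = k - r - 1\<close> replaces \<open>r * u (j + 1)\<close> by \<open>(r + 1) * (j + 1) * u j\<close>, and
  \<open>(r + 1) * (j + 1) \<le> r * (2 * j + 1)\<close> for \<open>r \<ge> 2\<close> and \<open>j \<ge> 1\<close>. The step to \<open>r = k\<close> would have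
  \<open>j = 0\<close>, where the inequality fails. At \<open>r = 2\<close> the claim is
  \<open>2 * (k - 2) * u (k - 2) < u (k - 1)\<close>.\<close>
lemma short_cover_bound:
  fixes u :: "nat \<Rightarrow> nat"
  assumes u: "\<And>j. (2 * j + 1) * u j \<le> u (Suc j)" and u0: "0 < u 0"
    and "2 \<le> r" "r < k"
  shows "r * ((k - 2) * (\<Prod>i=2..<r. k - i) * u (k - r)) < u (k - 1)"
  using \<open>2 \<le> r\<close> \<open>r < k\<close>
proof (induction r rule: dec_induct)
  case base
  have pos: "0 < u j" for j
    by (induction j) (use u0 u in \<open>auto intro: less_le_trans[OF _ u]\<close>)
  obtain i where i: "k = Suc (Suc (Suc i))"
    using base by (metis less_iff_Suc_add add_2_eq_Suc)
  have "2 * Suc i * u (Suc i) < (2 * Suc i + 1) * u (Suc i)" using pos by simp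
  also have "\<dots> \<le> u (Suc (Suc i))" by (rule u)
  finally show ?case by (simp add: i)
next
  case (step r)
  define j where "j = k - Suc r"
  have j: "k - r = Suc j" "1 \<le> j" "k - Suc r = j"
    using step.prems by (auto simp: j_def)
  define p where "p = (k - 2) * (\<Prod>i=2..<r. k - i)"
  have "Suc r * Suc j \<le> r * (2 * j + 1)"
  proof -
    obtain r' j' where "r = r' + 2" "j = j' + 1"
      using \<open>2 \<le> r\<close> j(2) by (metis add.commute le_Suc_ex)
    then show ?thesis by (simp add: algebra_simps)
  qed
  then have "Suc r * Suc j * (p * u j) \<le> r * (2 * j + 1) * (p * u j)" by (rule mult_le_mono1)
  also have "\<dots> = r * (p * ((2 * j + 1) * u j))" by (simp only: ac_simps)
  also have "\<dots> \<le> r * (p * u (Suc j))" using u by (intro mult_le_mono2)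
  also have "\<dots> < u (k - 1)" using step j by (simp add: p_def)
  finally show ?case
    using j \<open>2 \<le> r\<close> by (simp add: p_def ac_simps del: mult_Suc mult_Suc_right)
qed

text \<open>This is \<open>k * (k - 2) * fact (k - 2) < u (k - 1)\<close> for \<open>k = m + 5\<close>. It starts at \<open>k = 5\<close>,
  where it reads \<open>90 < 105\<close> for the smallest admissible \<open>u\<close>; for \<open>k = 4\<close> it would read
  \<open>16 < 15\<close>.\<close>
lemma factorial_odd_bound:
  fixes u :: "nat \<Rightarrow> nat"
  assumes u: "\<And>j. (2 * j + 1) * u j \<le> u (Suc j)" and u0: "0 < u 0"
  shows "(m + 5) * ((m + 3) * fact (m + 3)) < u (m + 4)"
proof (induction m)
  case 0
  have "1 \<le> u 1" "3 * u 1 \<le> u 2" "5 * u 2 \<le> u 3" "7 * u 3 \<le> u 4"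
    using u[of 0] u[of 1] u[of 2] u[of 3] u0 by (auto simp: eval_nat_numeral)
  then have "105 \<le> u 4" by linarith
  then show ?case by (simp add: fact_numeral)
next
  case (Suc m)
  have "(m + 6) * ((m + 4) * (m + 4)) \<le> (2 * (m + 4) + 1) * ((m + 5) * (m + 3))"
    by (simp add: algebra_simps)
  then have "(m + 6) * ((m + 4) * (m + 4)) * fact (m + 3)
      \<le> (2 * (m + 4) + 1) * ((m + 5) * (m + 3)) * fact (m + 3)"
    by (rule mult_le_mono1)
  also have "\<dots> = (2 * (m + 4) + 1) * ((m + 5) * ((m + 3) * fact (m + 3)))"
    by (simp only: ac_simps)
  also have "\<dots> < (2 * (m + 4) + 1) * u (m + 4)" using Suc.IH by simp
  also have "\<dots> \<le> u (Suc (m + 4))" by (rule u)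
  finally have "(m + 6) * ((m + 4) * (m + 4)) * fact (m + 3) < u (m + 5)"
    by (simp add: ac_simps)
  moreover have "(fact (m + 4) :: nat) = (m + 4) * fact (m + 3)"
    using fact_Suc[of "m + 3", where 'a = nat] by (simp add: eval_nat_numeral)
  ultimately show ?case by (simp add: ac_simps)
qed

lemma prod_descending_eq_fact:
  assumes "2 \<le> k"
  shows "(\<Prod>i=2..<k. k - i) = fact (k - 2)"
proof -
  have "(\<Prod>i=2..<k. k - i) = (\<Prod>i=1..k-2. i)"
    by (rule prod.reindex_bij_witness[of _ "\<lambda>i. k - i" "\<lambda>i. k - i"]) (use assms in auto)
  then show ?thesis by (simp add: fact_prod)
qed

text \<open>The left side is smaller than \<open>k * (k - 2) * fact (k - 2)\<close> by \<open>k - 1\<close>, which rescues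
  \<open>k = 3\<close> (\<open>1 < 3\<close>) and \<open>k = 4\<close> (\<open>13 < 15\<close>).\<close>
lemma long_cover_bound:
  fixes u :: "nat \<Rightarrow> nat"
  assumes u: "\<And>j. (2 * j + 1) * u j \<le> u (Suc j)" and u0: "0 < u 0"
    and k: "3 \<le> k"
  shows "1 + k * ((k - 2) * (\<Prod>i=2..<k. k - i) - 1) < u (k - 1)"
proof -
  have *: "1 \<le> u 1" "3 * u 1 \<le> u 2" "5 * u 2 \<le> u 3"
    using u[of 0] u[of 1] u[of 2] u0 by (auto simp: eval_nat_numeral)
  consider "k = 3" | "k = 4" | m where "k = m + 5"
  proof -
    have "k = 3 \<or> k = 4 \<or> k = (k - 5) + 5" using k by linarith
    then show ?thesis using that by blast
  qed
  then show ?thesis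
  proof cases
    case 3
    define d :: nat where "d = (m + 3) * fact (m + 3)"
    have "0 < d" by (simp add: d_def)
    then have "1 + k * (d - 1) \<le> k * d" using k by (cases d) auto
    moreover have "k * d < u (k - 1)"
      using factorial_odd_bound[OF u u0, of m] 3 by (simp add: d_def add.commute)
    moreover have "(k - 2) * (\<Prod>i=2..<k. k - i) = d"
      using prod_descending_eq_fact[of k] 3 by (simp add: d_def add.commute)
    ultimately show ?thesis by simp
  qed (use * in \<open>simp_all add: prod_descending_eq_fact fact_numeral\<close>)
qed

section \<open>Systems without a common class\<close>

locale intersecting_equipartitions =
  fixes X :: "'a set" and c k :: nat and M :: "'a set set set"
  assumes finite_ground: "finite X" and card_ground: "card X = c * k" and block_size: "0 < c"
    and members: "M \<subseteq> equipartitions c X"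
    and common_block: "\<And>P Q. P \<in> M \<Longrightarrow> Q \<in> M \<Longrightarrow> P \<inter> Q \<noteq> {}"
begin

definition star :: "'a set set \<Rightarrow> 'a set set set" where
  "star S = {P \<in> M. S \<subseteq> P}"

definition block_cover :: "'a set set \<Rightarrow> bool" where
  "block_cover C \<longleftrightarrow> finite C \<and> (\<forall>P\<in>M. C \<inter> P \<noteq> {})"

lemma finite_M: "finite M"
  using members finite_equipartitions[OF finite_ground] finite_subset by blast

lemma finite_star: "finite (star S)"
  using finite_M by (simp add: star_def)

lemma member:
  assumes "P \<in> M"
  shows "P \<in> equipartitions c X" "finite P" "card P = k"
proof -
  show P: "P \<in> equipartitions c X" using assms members by blast
  then show "finite P" by (rule finite_equipartition[OF finite_ground])
  show "card P = k" using card_equipartition[OF finite_ground P] card_ground block_size by simp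
qed

text \<open>The classes of \<open>Q\<close> that avoid \<open>\<Union>S\<close> fit, at \<open>c\<close> points each, into the
  \<open>c * (k - card S)\<close> points outside \<open>\<Union>S\<close>.\<close>
lemma card_disjoint_blocks_le:
  assumes "P \<in> M" "S \<subseteq> P" "Q \<in> M"
  shows "card {B \<in> Q. B \<inter> \<Union>S = {}} \<le> k - card S"
proof -
  let ?F = "{B \<in> Q. B \<inter> \<Union>S = {}}"
  have S: "\<Union>S \<subseteq> X" "card (\<Union>S) = c * card S"
    using card_equal_blocks[OF finite_ground member(1)[OF assms(1)] assms(2)]
      equipartitionsD(3)[OF member(1)[OF assms(1)]] assms(2) by auto
  have "c * card ?F = card (\<Union>?F)"
    by (rule card_equal_blocks[OF finite_ground member(1)[OF assms(3)], symmetric]) auto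
  also have "\<dots> \<le> card (X - \<Union>S)"
    by (rule card_mono)
       (use finite_ground equipartitionsD(3)[OF member(1)[OF assms(3)]] in auto)
  also have "\<dots> = c * (k - card S)"
    using S finite_ground card_ground by (simp add: card_Diff_subset finite_subset diff_mult_distrib2)
  finally show ?thesis using block_size by simp
qed

text \<open>A class \<open>A\<close> that is not in \<open>Q\<close> meets at least two classes of \<open>Q\<close>, because it has the same
  size as each of them. This saving of one over \<open>card_disjoint_blocks_le\<close> is essential: for
  \<open>c = 2\<close> and \<open>r = 2\<close> the final comparison is \<open>2 * (k - 2) < 2 * k - 3\<close>, which holds by one.\<close>
lemma card_disjoint_blocks_le_of_new:
  assumes "P \<in> M" "A \<in> P" "Q \<in> M" "A \<notin> Q"
  shows "card {B \<in> Q. B \<inter> A = {}} \<le> k - 2"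
proof -
  note P = equipartitionsD[OF member(1)[OF assms(1)]]
  note Q = equipartitionsD[OF member(1)[OF assms(3)]]
  obtain x where x: "x \<in> A" using P(4) assms(2) by blast
  then obtain B where B: "B \<in> Q" "x \<in> B" using P(3) Q(1) assms(2) by blast
  have "\<not> A \<subseteq> B"
  proof
    assume "A \<subseteq> B"
    moreover have "finite B" using Q(3) B(1) finite_ground finite_subset by blast
    ultimately have "A = B" using P(2)[OF assms(2)] Q(2)[OF B(1)] card_subset_eq by metis
    then show False using B(1) assms(4) by simp
  qed
  then obtain y where y: "y \<in> A" "y \<notin> B" by blast
  then obtain B' where B': "B' \<in> Q" "y \<in> B'" using P(3) Q(1) assms(2) by blast
  have "{B \<in> Q. B \<inter> A = {}} \<subseteq> Q - {B, B'}" using B B' x y by auto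
  then have "card {B \<in> Q. B \<inter> A = {}} \<le> card (Q - {B, B'})"
    using member(2)[OF assms(3)] by (intro card_mono) auto
  also have "\<dots> = k - 2"
  proof -
    have "card {B, B'} = 2" using B' y by (metis card_2_iff)
    then show ?thesis using B B' member(2,3)[OF assms(3)] by (subst card_Diff_subset) auto
  qed
  finally show ?thesis .
qed

text \<open>A member containing \<open>S\<close> shares a class \<open>B\<close> with \<open>Q\<close>. As \<open>B\<close> is not in \<open>S\<close>, it is
  disjoint from every class in \<open>S\<close>, so it is one of at most \<open>m\<close> classes of \<open>Q\<close>.\<close>
lemma card_star_branch:
  assumes Q: "Q \<in> M" "S \<inter> Q = {}"
    and free: "\<And>P. P \<in> M \<Longrightarrow> S \<subseteq> P \<Longrightarrow> card {B \<in> Q. B \<inter> \<Union>S = {}} \<le> m"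
    and ext: "\<And>B. B \<in> Q \<Longrightarrow> card (star (insert B S)) \<le> d"
  shows "card (star S) \<le> m * d"
proof (cases "star S = {}")
  case False
  then obtain P where P: "P \<in> M" "S \<subseteq> P" by (auto simp: star_def)
  let ?F = "{B \<in> Q. B \<inter> \<Union>S = {}}"
  have finF: "finite ?F" using member(2)[OF Q(1)] by simp
  have "star S \<subseteq> (\<Union>B\<in>?F. star (insert B S))"
  proof
    fix R assume "R \<in> star S"
    then have R: "R \<in> M" "S \<subseteq> R" by (auto simp: star_def)
    obtain B where B: "B \<in> R" "B \<in> Q" using common_block[OF R(1) Q(1)] by blast
    have "B \<inter> A = {}" if "A \<in> S" for A
      using equipartitionsD(5)[OF member(1)[OF R(1)]] that B R(2) Q(2) by blast
    then have "B \<in> ?F" using B by blast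
    then show "R \<in> (\<Union>B\<in>?F. star (insert B S))" using R B by (auto simp: star_def)
  qed
  then have "card (star S) \<le> card (\<Union>B\<in>?F. star (insert B S))"
    using finF finite_star by (intro card_mono) auto
  also have "\<dots> \<le> (\<Sum>B\<in>?F. card (star (insert B S)))" by (rule card_UN_le[OF finF])
  also have "\<dots> \<le> card ?F * d" using sum_bounded_above[of ?F _ d] ext by auto
  also have "\<dots> \<le> m * d" using free[OF P] by simp
  finally show ?thesis .
qed simp

lemma card_star_le_num_equipartitions:
  "card (star S) \<le> num_equipartitions c (k - card S)"
proof (cases "star S = {}")
  case False
  then obtain P where P: "P \<in> M" "S \<subseteq> P" by (auto simp: star_def)
  note D = equipartitionsD[OF member(1)[OF P(1)]]
  have S: "disjoint S" "\<Union>S \<subseteq> X" "\<And>A. A \<in> S \<Longrightarrow> card A = c"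
    using D(2,3,5) P(2) unfolding disjoint_def by (meson subsetD) (use D(2,3) P(2) in blast)+
  have "card (star S) \<le> card {P \<in> equipartitions c X. S \<subseteq> P}"
    using members finite_equipartitions[OF finite_ground]
    by (intro card_mono) (auto simp: star_def)
  also have "\<dots> = card (equipartitions c (X - \<Union>S))"
    by (rule card_equipartitions_containing[OF finite_ground S block_size])
  also have "\<dots> = num_equipartitions c (k - card S)"
    by (rule card_equipartitions)
       (use S finite_ground card_ground card_equal_blocks[OF finite_ground member(1)[OF P(1)] P(2)]
        in \<open>auto simp: card_Diff_subset finite_subset diff_mult_distrib2\<close>)
  finally show ?thesis .
qed simp

text \<open>A set with fewer than \<open>r\<close> classes is not a cover, so some member avoids it and
  \<open>card_star_branch\<close> enlarges it by one class; this is repeated until it has \<open>r\<close> classes.\<close>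
lemma card_star_le:
  assumes min: "\<And>C. block_cover C \<Longrightarrow> r \<le> card C"
    and S: "finite S" "card S \<le> r"
  shows "card (star S) \<le> (\<Prod>i=card S..<r. k - i) * num_equipartitions c (k - r)"
  using S
proof (induction "r - card S" arbitrary: S)
  case 0
  then show ?case using card_star_le_num_equipartitions[of S] by simp
next
  case (Suc n)
  have "\<not> block_cover S" using min[of S] Suc.hyps(2) by auto
  then obtain Q where Q: "Q \<in> M" "S \<inter> Q = {}"
    using Suc.prems by (auto simp: block_cover_def)
  have "card (star S) \<le> (k - card S) *
      ((\<Prod>i=Suc (card S)..<r. k - i) * num_equipartitions c (k - r))"
  proof (rule card_star_branch[OF Q card_disjoint_blocks_le[OF _ _ Q(1)]])
    fix B assume "B \<in> Q"
    then have "card (insert B S) = Suc (card S)" using Q Suc.prems by (subst card_insert_disjoint) auto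
    then show "card (star (insert B S)) \<le>
        (\<Prod>i=Suc (card S)..<r. k - i) * num_equipartitions c (k - r)"
      using Suc.hyps(1)[of "insert B S"] Suc.hyps(2) Suc.prems by simp
  qed
  also have "\<dots> = (\<Prod>i=card S..<r. k - i) * num_equipartitions c (k - r)"
    using Suc.hyps(2) by (simp add: prod.atLeast_Suc_lessThan)
  finally show ?case .
qed

lemma card_star_singleton_le:
  assumes min: "\<And>C. block_cover C \<Longrightarrow> r \<le> card C" and r: "2 \<le> r"
  shows "card (star {A}) \<le> (k - 2) * ((\<Prod>i=2..<r. k - i) * num_equipartitions c (k - r))"
proof -
  have "\<not> block_cover {A}" using min[of "{A}"] r by auto
  then obtain Q where Q: "Q \<in> M" "A \<notin> Q" by (auto simp: block_cover_def)
  show ?thesis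
  proof (rule card_star_branch[where Q = Q])
    fix P assume "P \<in> M" "{A} \<subseteq> P"
    then show "card {B \<in> Q. B \<inter> \<Union>{A} = {}} \<le> k - 2"
      using card_disjoint_blocks_le_of_new[of P A Q] Q by simp
  next
    fix B assume "B \<in> Q"
    then have "card {B, A} = 2" using Q by (metis card_2_iff)
    then show "card (star {B, A}) \<le> (\<Prod>i=2..<r. k - i) * num_equipartitions c (k - r)"
      using card_star_le[OF min, of "{B, A}"] r by simp
  qed (use Q in auto)
qed

theorem card_lt_if_no_common_block:
  assumes c: "2 \<le> c" and "M \<noteq> {}" and no_common: "\<And>A. \<exists>P\<in>M. A \<notin> P"
  shows "card M < num_equipartitions c (k - 1)"
proof -
  obtain P where P: "P \<in> M" using \<open>M \<noteq> {}\<close> by blast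
  have "block_cover P"
    using common_block[OF P] member(2)[OF P] by (auto simp: block_cover_def)
  then obtain C where C: "block_cover C" and min: "\<And>D. block_cover D \<Longrightarrow> card C \<le> card D"
    using exists_least_iff[of "\<lambda>n. \<exists>C. block_cover C \<and> card C = n"] by (metis not_le)
  define r where "r = card C"
  have finC: "finite C" using C by (simp add: block_cover_def)
  \<comment> \<open>An empty cover needs an empty system, and a cover by one class is a common class.\<close>
  have "r \<noteq> 0" using C P finC by (auto simp: r_def block_cover_def)
  moreover have "r \<noteq> 1"
    using C no_common by (auto simp: r_def block_cover_def card_1_singleton_iff)
  ultimately have r: "2 \<le> r" by linarith
  have "r \<le> k" using min[OF \<open>block_cover P\<close>] member(3)[OF P] by (simp add: r_def)
  define d where "d = (k - 2) * ((\<Prod>i=2..<r. k - i) * num_equipartitions c (k - r))"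
  have d: "card (star {A}) \<le> d" for A
    unfolding d_def by (rule card_star_singleton_le[OF _ r]) (use min in \<open>simp add: r_def\<close>)
  have u: "(2 * j + 1) * num_equipartitions c j \<le> num_equipartitions c (Suc j)" for j
    by (rule num_equipartitions_Suc[OF c])
  have u0: "0 < num_equipartitions c 0" by (simp add: num_equipartitions_0)
  show ?thesis
  proof (cases "r < k")
    case True
    have "M \<subseteq> (\<Union>A\<in>C. star {A})" using C by (auto simp: block_cover_def star_def)
    then have "card M \<le> card (\<Union>A\<in>C. star {A})"
      using finC finite_star by (intro card_mono) auto
    also have "\<dots> \<le> (\<Sum>A\<in>C. card (star {A}))" by (rule card_UN_le[OF finC])
    also have "\<dots> \<le> r * d" using sum_bounded_above[of C _ d] d by (auto simp: r_def)
    also have "\<dots> < num_equipartitions c (k - 1)"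
      using short_cover_bound[OF u u0 r True] by (simp add: d_def ac_simps)
    finally show ?thesis .
  next
    case False
    then have rk: "r = k" using \<open>r \<le> k\<close> by simp
    obtain A where "A \<in> P" using common_block[OF P P] by blast
    then have "star {A} \<noteq> {}" using P by (auto simp: star_def)
    then have "0 < d" using d[of A] finite_star card_gt_0_iff le_trans less_le_trans by metis
    \<comment> \<open>For \<open>k = 2\<close> the factor \<open>k - 2\<close> of \<open>d\<close> vanishes, although \<open>A\<close> lies in a member.\<close>
    then have k: "3 \<le> k" by (auto simp: d_def intro: ccontr)
    \<comment> \<open>\<open>P\<close> lies in \<open>star {A}\<close> for every \<open>A \<in> P\<close>; it is set aside and counted only once.\<close>
    have "M - {P} \<subseteq> (\<Union>A\<in>P. star {A} - {P})"
      using common_block[OF P] by (auto simp: star_def)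
    then have "card (M - {P}) \<le> card (\<Union>A\<in>P. star {A} - {P})"
      using member(2)[OF P] finite_star by (intro card_mono) auto
    also have "\<dots> \<le> (\<Sum>A\<in>P. card (star {A} - {P}))" by (rule card_UN_le[OF member(2)[OF P]])
    also have "\<dots> \<le> (\<Sum>A\<in>P. d - 1)"
    proof (rule sum_mono)
      fix A assume "A \<in> P"
      then have "P \<in> star {A}" using P by (simp add: star_def)
      then show "card (star {A} - {P}) \<le> d - 1" using d[of A] by (simp add: diff_le_mono)
    qed
    finally have "card M \<le> 1 + k * (d - 1)"
      using member(3)[OF P] P finite_M by (simp add: card_Diff_singleton)
    also have "\<dots> < num_equipartitions c (k - 1)"
      using long_cover_bound[OF u u0 k] rk by (simp add: d_def num_equipartitions_0)
    finally show ?thesis .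
  qed
qed

end

section \<open>Trivially intersecting systems\<close>

lemma uniform_partitions_eq:
  assumes "0 < c"
  shows "uniform_partitions (c * k) k = equipartitions c {1..c * k}"
proof (cases "k = 0")
  case True
  then show ?thesis
    by (auto simp: uniform_partitions_def equipartitions_def partition_on_empty)
next
  case False
  then have "card P = k" if "P \<in> equipartitions c {1..c * k}" for P
    using card_equipartition[OF _ that] assms by simp
  then show ?thesis using False
    by (auto simp: uniform_partitions_def equipartitions_def)
qed

lemma canonical_system_1:
  "canonical_system n k 1 = {P \<in> uniform_partitions n k. {1..n div k} \<in> P}"
  by (auto simp: canonical_system_def Let_def)

lemma permutes_onto:
  assumes "finite X" "A \<subseteq> X" "B \<subseteq> X" "card A = card B"
  obtains \<sigma> where "\<sigma> permutes X" "\<sigma> ` A = B"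
proof -
  have fin: "finite A" "finite B" using assms finite_subset by auto
  obtain f where f: "bij_betw f A B" using finite_same_card_bij fin assms(4) by blast
  have "card (X - A) = card (X - B)" using assms fin by (simp add: card_Diff_subset)
  then obtain g where g: "bij_betw g (X - A) (X - B)"
    using finite_same_card_bij assms(1) by (metis finite_Diff)
  define \<sigma> where "\<sigma> x = (if x \<in> A then f x else if x \<in> X then g x else x)" for x
  have A: "bij_betw \<sigma> A B" using f by (rule bij_betw_cong[THEN iffD1, rotated]) (simp add: \<sigma>_def)
  have "bij_betw \<sigma> (X - A) (X - B)"
    using g by (rule bij_betw_cong[THEN iffD1, rotated]) (simp add: \<sigma>_def)
  with A have "bij_betw \<sigma> (A \<union> (X - A)) (B \<union> (X - B))"
    by (rule bij_betw_combine) auto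
  then have "bij_betw \<sigma> X X" using assms by (simp add: Un_absorb1)
  then have "\<sigma> permutes X"
    by (rule bij_imp_permutes) (use assms(2) in \<open>auto simp: \<sigma>_def\<close>)
  moreover have "\<sigma> ` A = B" using A by (simp add: bij_betw_def)
  ultimately show ?thesis by (rule that)
qed

lemma permutation_image_equipartitions_containing:
  assumes "\<sigma> permutes X"
  shows "(\<lambda>P. (`) \<sigma> ` P) ` {P \<in> equipartitions c X. A \<in> P}
    = {P \<in> equipartitions c X. \<sigma> ` A \<in> P}"
proof (intro subset_antisym subsetI)
  fix Q assume "Q \<in> (\<lambda>P. (`) \<sigma> ` P) ` {P \<in> equipartitions c X. A \<in> P}"
  then show "Q \<in> {P \<in> equipartitions c X. \<sigma> ` A \<in> P}"
    using image_equipartition[OF permutes_imp_bij[OF assms]] by auto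
next
  fix Q assume Q: "Q \<in> {P \<in> equipartitions c X. \<sigma> ` A \<in> P}"
  have inv: "inv \<sigma> permutes X" using assms by (rule permutes_inv)
  have "(`) (inv \<sigma>) ` Q \<in> equipartitions c X"
    using image_equipartition[OF permutes_imp_bij[OF inv]] Q by blast
  moreover have "A \<in> (`) (inv \<sigma>) ` Q"
  proof -
    have "inv \<sigma> ` \<sigma> ` A = A"
      using permutes_inverses(2)[OF assms] by (simp add: image_image)
    then show ?thesis using Q by (metis (mono_tags) image_eqI mem_Collect_eq)
  qed
  moreover have "Q = (`) \<sigma> ` (`) (inv \<sigma>) ` Q"
    by (rule image_image_inverse[symmetric]) (rule permutes_inverses(1)[OF assms])
  ultimately show "Q \<in> (\<lambda>P. (`) \<sigma> ` P) ` {P \<in> equipartitions c X. A \<in> P}" by blast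
qed

text \<open>The permutations of the ground set act transitively on its \<open>c\<close>-subsets and permute the
  partitions, so the images of the canonical system are the systems of all partitions containing
  some fixed \<open>c\<close>-set.\<close>
lemma trivially_1_intersecting_iff:
  assumes "0 < c" "0 < k"
  shows "trivially_t_intersecting (c * k) k 1 \<P> \<longleftrightarrow>
    (\<exists>A \<subseteq> {1..c * k}. card A = c \<and> \<P> = {P \<in> equipartitions c {1..c * k}. A \<in> P})"
    (is "?lhs \<longleftrightarrow> ?rhs")
proof -
  let ?X = "{1..c * k}"
  have canon: "canonical_system (c * k) k 1 = {P \<in> equipartitions c ?X. {1..c} \<in> P}"
    using assms unfolding canonical_system_1 by (simp add: uniform_partitions_eq)
  have sub: "{1..c} \<subseteq> ?X" using assms by (auto intro: order_trans)
  show ?thesis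
  proof
    assume ?lhs
    then obtain \<sigma> where s: "\<sigma> permutes ?X"
      and "\<P> = (\<lambda>P. (`) \<sigma> ` P) ` {P \<in> equipartitions c ?X. {1..c} \<in> P}"
      unfolding trivially_t_intersecting_def canon by blast
    then have "\<P> = {P \<in> equipartitions c ?X. \<sigma> ` {1..c} \<in> P}"
      using permutation_image_equipartitions_containing[OF s] by simp
    moreover have "\<sigma> ` {1..c} \<subseteq> ?X" using sub permutes_image[OF s] by blast
    moreover have "card (\<sigma> ` {1..c}) = c"
      using card_image[OF inj_on_subset[OF permutes_inj[OF s]]] by simp
    ultimately show ?rhs by blast
  next
    assume ?rhs
    then obtain A where A: "A \<subseteq> ?X" "card A = c"
      "\<P> = {P \<in> equipartitions c ?X. A \<in> P}" by blast
    obtain \<sigma> where s: "\<sigma> permutes ?X" "\<sigma> ` {1..c} = A"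
      using permutes_onto[of ?X "{1..c}" A] sub A by auto
    then have "\<P> = (\<lambda>P. (`) \<sigma> ` P) ` {P \<in> equipartitions c ?X. {1..c} \<in> P}"
      using permutation_image_equipartitions_containing[OF s(1)] A(3) by simp
    then show ?lhs unfolding trivially_t_intersecting_def canon using s(1) by blast
  qed
qed

section \<open>The bound and its equality case\<close>

theorem theorem7p2p3:
  fixes n k c :: nat and \<P> :: "nat set set set"
  assumes "1 \<le> k" and "k \<le> n" and "k dvd n" and "c = n div k"
    and "\<P> \<subseteq> uniform_partitions n k"
    and "t_intersecting 1 \<P>"
  shows "card \<P> \<le> U (n - c) (k - 1) \<and>
         (card \<P> = U (n - c) (k - 1) \<longleftrightarrow> trivially_t_intersecting n k 1 \<P>)"
proof -
  let ?X = "{1..n}"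
  have n: "n = c * k" using assms(3,4) by simp
  have c: "0 < c" using assms(1,2,4) by (simp add: div_greater_zero_iff)
  have sub: "\<P> \<subseteq> equipartitions c ?X"
    using assms(5) uniform_partitions_eq[OF c, of k] n by simp
  interpret intersecting_equipartitions ?X c k \<P>
  proof
    show "P \<inter> Q \<noteq> {}" if "P \<in> \<P>" "Q \<in> \<P>" for P Q
      using assms(6) that by (force simp: t_intersecting_def)
  qed (use n c sub in auto)
  have U: "U (n - c) (k - 1) = num_equipartitions c (k - 1)"
  proof -
    have "n - c = c * (k - 1)" using n by (simp add: diff_mult_distrib2)
    then show ?thesis
      by (simp add: U_def uniform_partitions_eq[OF c] card_equipartitions)
  qed
  have star_card: "card {P \<in> equipartitions c ?X. A \<in> P} = num_equipartitions c (k - 1)"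
    if "A \<subseteq> ?X" "card A = c" for A
  proof -
    have "card {P \<in> equipartitions c ?X. {A} \<subseteq> P} = card (equipartitions c (?X - \<Union>{A}))"
      by (rule card_equipartitions_containing) (use that c in auto)
    also have "\<dots> = num_equipartitions c (k - 1)"
      by (rule card_equipartitions)
         (use that n in \<open>auto simp: card_Diff_subset finite_subset diff_mult_distrib2\<close>)
    finally show ?thesis by simp
  qed
  have triv: "trivially_t_intersecting n k 1 \<P> \<longleftrightarrow>
      (\<exists>A \<subseteq> ?X. card A = c \<and> \<P> = {P \<in> equipartitions c ?X. A \<in> P})"
    using trivially_1_intersecting_iff[OF c, of k \<P>] assms(1) n by simp
  show ?thesis
  proof (cases "\<exists>A \<subseteq> ?X. card A = c \<and> (\<forall>P\<in>\<P>. A \<in> P)")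
    case True
    then obtain A where A: "A \<subseteq> ?X" "card A = c" "\<P> \<subseteq> {P \<in> equipartitions c ?X. A \<in> P}"
      using sub by blast
    have fin: "finite {P \<in> equipartitions c ?X. A \<in> P}"
      by (simp add: finite_equipartitions)
    show ?thesis
    proof (intro conjI iffI)
      show "card \<P> \<le> U (n - c) (k - 1)"
        unfolding U using card_mono[OF fin A(3)] star_card[OF A(1,2)] by simp
      show "trivially_t_intersecting n k 1 \<P>" if "card \<P> = U (n - c) (k - 1)"
      proof -
        have "\<P> = {P \<in> equipartitions c ?X. A \<in> P}"
          by (rule card_subset_eq[OF fin A(3)]) (simp only: that U star_card[OF A(1,2)])
        then show ?thesis unfolding triv using A(1,2) by blast
      qed
      show "card \<P> = U (n - c) (k - 1)" if "trivially_t_intersecting n k 1 \<P>"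
        using that star_card unfolding triv U by blast
    qed
  next
    case False
    then have not_triv: "\<not> trivially_t_intersecting n k 1 \<P>" unfolding triv by blast
    have ne: "\<P> \<noteq> {}"
    proof
      assume "\<P> = {}"
      moreover have "{1..c} \<subseteq> ?X" using n assms(1) by auto
      moreover have "card {1..c} = c" by simp
      ultimately show False using False by blast
    qed
    have no_common: "\<exists>P\<in>\<P>. A \<notin> P" for A
    proof (rule ccontr)
      assume no: "\<not> (\<exists>P\<in>\<P>. A \<notin> P)"
      obtain P where "P \<in> \<P>" using ne by blast
      then have "A \<subseteq> ?X" "card A = c"
        using no equipartitionsD(2,3)[OF subsetD[OF sub]] by blast+
      then show False using False no by blast
    qed
    have "2 \<le> c"
    proof (rule ccontr)
      assume "\<not> 2 \<le> c"
      then have "c = 1" using c by simp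
      have "{1} \<in> P" if "P \<in> \<P>" for P
      proof -
        note D = equipartitionsD[OF subsetD[OF sub that]]
        have "1 \<in> ?X" using assms(1,2) by simp
        then obtain A where A: "A \<in> P" "1 \<in> A" using D(1) by blast
        then obtain x where "A = {x}" using D(2)[OF A(1)] \<open>c = 1\<close> by (auto simp: card_1_singleton_iff)
        then show ?thesis using A by simp
      qed
      then show False using no_common by blast
    qed
    then have "card \<P> < U (n - c) (k - 1)"
      unfolding U by (rule card_lt_if_no_common_block[OF _ ne no_common])
    then show ?thesis using not_triv by simp
  qed
qed

end
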